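(* For fixed $R>0$ and $L\ge 0$, the cyclic averages of equal powers of various regular $n$-gons are the same: for all integers $3\le n_1\le n_2$ and all $m$ with $1\le m\le n_1-1$, $$S_{n_1}^{(2m)}=S_{n_2}^{(2m)}.$$ In particular $S_3^{(2)}=S_4^{(2)}=S_5^{(2)}=\cdots$, $S_3^{(4)}=S_4^{(4)}=S_5^{(4)}=\cdots$, $S_4^{(6)}=S_5^{(6)}=S_6^{(6)}=\cdots$, $S_5^{(8)}=S_6^{(8)}=\cdots$.
   Context: For a regular $n$-gon with vertices $A_1,\dots,A_n$, circumradius $R$ and centroid $O$, a point $M$ of its plane with $|MO|=L$, and $1\le m\le n-1$, the cyclic average is $S_n^{(2m)}=\frac1n\sum_{i=1}^n |MA_i|^{2m}$; for such $m$ its value depends only on $R$ and $L$, not on the position of $M$ on the circle of radius $L$ about $O$. The equality compares the regular $n_1$-gon and the regular $n_2$-gon having the same circumradius $R$, with points at the same distance $L$ from the respective centroids. *)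

theory Defs
  imports "HOL-Analysis.Analysis"
begin

text \<open>
  The plane is \<^typ>\<open>complex\<close> with its Euclidean metric. The vertices of an n-gon are
  \<open>A 1, \<dots>, A n\<close>, listed in cyclic order; values of \<open>A\<close> outside \<open>{1..n}\<close> are irrelevant.
\<close>

text \<open>
  Regular n-gon of circumradius \<open>R\<close>: equally spaced points on a circle of radius \<open>R\<close>, in
  arbitrary position. The sign \<open>s\<close> admits both directions of traversal.
\<close>

definition regular_polygon :: "nat \<Rightarrow> (nat \<Rightarrow> complex) \<Rightarrow> real \<Rightarrow> bool" where
  "regular_polygon n A R \<longleftrightarrow> 3 \<le> n \<and> 0 < R \<and>
     (\<exists>c \<phi> s. s \<in> {1, -1} \<and>
       (\<forall>i\<in>{1..n}. A i = c + rcis R (\<phi> + s * (2 * pi * real i / real n))))"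

definition centroid :: "nat \<Rightarrow> (nat \<Rightarrow> complex) \<Rightarrow> complex" where
  "centroid n A = (\<Sum>i=1..n. A i) / of_nat n"

text \<open>The exponent \<open>k\<close> is the full power of the distance, so \<open>k = 2 * m\<close> gives $S_n^{(2m)}$.\<close>

definition cyclic_average :: "nat \<Rightarrow> (nat \<Rightarrow> complex) \<Rightarrow> complex \<Rightarrow> nat \<Rightarrow> real" where
  "cyclic_average n A M k = (1 / real n) * (\<Sum>i=1..n. dist M (A i) ^ k)"

end

theory Submission
  imports Defs "HOL-Library.Real_Mod"
begin

text \<open>
  Put the centroid at the origin and write the vertices as \<open>R z\<close> with \<open>|z| = 1\<close>. Then
  \<open>|w - R z|^(2m) = (w - R z)^m * (cnj w - R * cnj z)^m\<close> is a combination of the monomials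
  \<open>z^j * cnj z^k\<close> with \<open>j, k \<le> m < n\<close>. By orthogonality of the characters of the cyclic group,
  averaging over the vertices kills all of them except the diagonal ones, so the average
  is \<open>\<Sum>j\<le>m. (m choose j)^2 * R^(2j) * |w|^(2(m - j))\<close>, which does not depend on \<open>n\<close>.
\<close>

text \<open>Up to the constant phase \<open>cis t\<close>, the summands are the powers of an n-th
  root of unity \<open>x\<close>. The divisibility assumption says exactly that \<open>x\<close>
  differs from 1 when n > 0, so the geometric series vanishes.\<close>

lemma sum_cis_equally_spaced:
  fixes d :: int
  assumes "\<not> int n dvd d"
  shows "(\<Sum>i=1..n. cis (t + of_int d * (2 * pi * real i / real n))) = 0"
proof (cases "n = 0")
  case False
  hence n: "n > 0" by simp
  define x where "x = cis (of_int d * (2 * pi / real n))"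
  have "x \<noteq> 1"
  proof
    assume "x = 1"
    then obtain k :: int where "of_int d * (2 * pi / real n) = of_int k * (2 * pi)"
      by (auto simp: x_def cis_eq_1_iff)
    hence "real_of_int d = of_int (int n * k)"
      using n by (simp add: field_simps)
    hence "d = int n * k"
      by (simp only: of_int_eq_iff)
    with assms show False by simp
  qed
  have "x ^ n = cis (of_int d * (2 * pi))"
    using n by (simp add: x_def Complex.DeMoivre mult_ac)
  hence "x ^ n = 1"
    by (auto simp: cis_eq_1_iff)
  have "(\<Sum>i=1..n. cis (t + of_int d * (2 * pi * real i / real n)))
      = (\<Sum>i=1..n. cis t * x ^ i)"
    by (intro sum.cong refl) (simp add: x_def Complex.DeMoivre cis_mult mult_ac)
  \<comment> \<open>Shifting the index from 1..n to 0..n-1 pulls out one factor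
    \<open>x\<close>.\<close>
  also have "\<dots> = cis t * x * (\<Sum>i<n. x ^ i)"
    by (simp add: sum_distrib_left mult_ac sum.atLeast1_atMost_eq)
  also have "(\<Sum>i<n. x ^ i) = 0"
    using \<open>x \<noteq> 1\<close> \<open>x ^ n = 1\<close> by (simp add: sum_gp_strict)
  finally show ?thesis by simp
qed simp

text \<open>Conjugation negates the angle, so each monomial is a character of frequency plus or
  minus j - k. Both exponents lie below n, hence n divides this frequency only if j = k.\<close>

lemma sum_monomials_equally_spaced:
  fixes s \<phi> :: real and z :: "nat \<Rightarrow> complex"
  assumes "s \<in> {1, -1}" "j < n" "k < n"
  defines "z \<equiv> \<lambda>i. cis (\<phi> + s * (2 * pi * real i / real n))"
  shows "(\<Sum>i=1..n. z i ^ j * cnj (z i) ^ k) = (if j = k then of_nat n else 0)"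
proof -
  \<comment> \<open>The sign is made an integer so that the frequency \<open>d\<close> is one too
    and divisibility by n makes sense.\<close>
  obtain e :: int where s: "s = of_int e" and e: "e \<in> {1, -1}"
    using assms(1) by (metis insertE insertI1 insertI2 of_int_1 of_int_minus singletonD)
  define d where "d = (int j - int k) * e"
  have *: "z i ^ j * cnj (z i) ^ k
         = cis ((real j - real k) * \<phi> + of_int d * (2 * pi * real i / real n))" for i
    unfolding z_def cis_cnj Complex.DeMoivre cis_mult
    by (rule arg_cong[where f = cis]) (simp add: d_def s algebra_simps diff_divide_distrib)
  show ?thesis
  proof (cases "j = k")
    case True
    thus ?thesis unfolding * by (simp add: d_def)
  next
    case False
    hence "d \<noteq> 0" "\<bar>d\<bar> < int n"
      using e assms(2,3) by (auto simp: d_def)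
    hence "\<not> int n dvd d"
      using zdvd_not_zless[of "\<bar>d\<bar>" "int n"] by auto
    from sum_cis_equally_spaced[OF this] False show ?thesis
      unfolding * by simp
  qed
qed

lemma of_real_norm_power_even:
  "complex_of_real (norm v ^ (2 * l)) = v ^ l * cnj v ^ l"
  unfolding power_mult_distrib[symmetric] complex_norm_square[symmetric] power_mult by simp

text \<open>The binomial theorem is applied to each of the two conjugate factors. The last bracket
  isolates \<open>z\<close>, the only quantity that changes from vertex to vertex.\<close>

lemma norm_diff_power_expansion:
  fixes w z :: complex and R :: real
  shows "complex_of_real (norm (w - of_real R * z) ^ (2 * m))
       = (\<Sum>j\<le>m. \<Sum>k\<le>m. of_nat (m choose j) * of_nat (m choose k) * (- of_real R) ^ (j + k)
            * w ^ (m - j) * cnj w ^ (m - k) * (z ^ j * cnj z ^ k))"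
proof -
  have "complex_of_real (norm (w - of_real R * z) ^ (2 * m))
      = (- of_real R * z + w) ^ m * (- of_real R * cnj z + cnj w) ^ m"
    unfolding of_real_norm_power_even by simp
  also have "\<dots> = (\<Sum>j\<le>m. \<Sum>k\<le>m.
      (of_nat (m choose j) * (- of_real R * z) ^ j * w ^ (m - j))
      * (of_nat (m choose k) * (- of_real R * cnj z) ^ k * cnj w ^ (m - k)))"
    by (simp only: binomial_ring sum_product)
  also have "\<dots> = (\<Sum>j\<le>m. \<Sum>k\<le>m. of_nat (m choose j) * of_nat (m choose k)
      * (- of_real R) ^ (j + k) * w ^ (m - j) * cnj w ^ (m - k) * (z ^ j * cnj z ^ k))"
    by (intro sum.cong refl) (simp only: power_mult_distrib power_add mult_ac)
  finally show ?thesis .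
qed

theorem cyclic_average_regular_polygon:
  assumes "regular_polygon n A R" "m < n"
  shows "cyclic_average n A M (2 * m)
       = (\<Sum>j\<le>m. real (m choose j) ^ 2 * R ^ (2 * j) * dist M (centroid n A) ^ (2 * (m - j)))"
proof -
  obtain c \<phi> s where s: "s \<in> {1, -1::real}" and n: "3 \<le> n"
    and A: "\<And>i. i \<in> {1..n} \<Longrightarrow> A i = c + rcis R (\<phi> + s * (2 * pi * real i / real n))"
    using assms(1) unfolding regular_polygon_def by blast
  define z where "z = (\<lambda>i. cis (\<phi> + s * (2 * pi * real i / real n)))"
  have A_z: "A i = c + of_real R * z i" if "i \<in> {1..n}" for i
    using A[OF that] by (simp add: z_def rcis_def)
  have orth: "(\<Sum>i=1..n. z i ^ j * cnj (z i) ^ k) = (if j = k then of_nat n else 0)"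
    if "j < n" "k < n" for j k
    unfolding z_def by (rule sum_monomials_equally_spaced[OF s that])
  have "(\<Sum>i=1..n. A i) = of_nat n * c + of_real R * (\<Sum>i=1..n. z i)"
    by (simp add: A_z sum.distrib sum_distrib_left)
  \<comment> \<open>Orthogonality with exponents 1 and 0 identifies the centre \<open>c\<close> of
    the circle with the centroid.\<close>
  also have "(\<Sum>i=1..n. z i) = 0"
    using orth[of 1 0] n by simp
  finally have centroid: "centroid n A = c"
    using n by (simp add: centroid_def)
  define w where "w = M - c"
  define a where "a = (\<lambda>j k. of_nat (m choose j) * of_nat (m choose k)
    * (- complex_of_real R) ^ (j + k) * w ^ (m - j) * cnj w ^ (m - k))"
  have dist_eq: "dist M (A i) = norm (w - of_real R * z i)" if "i \<in> {1..n}" for i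
    using A_z[OF that] by (simp add: dist_norm w_def algebra_simps)
  have "complex_of_real (\<Sum>i=1..n. dist M (A i) ^ (2 * m))
      = (\<Sum>i=1..n. \<Sum>j\<le>m. \<Sum>k\<le>m. a j k * (z i ^ j * cnj (z i) ^ k))"
    unfolding of_real_sum a_def
    by (intro sum.cong refl) (simp only: dist_eq norm_diff_power_expansion)
  also have "\<dots> = (\<Sum>j\<le>m. \<Sum>i=1..n. \<Sum>k\<le>m. a j k * (z i ^ j * cnj (z i) ^ k))"
    by (rule sum.swap)
  also have "\<dots> = (\<Sum>j\<le>m. \<Sum>k\<le>m. a j k * (\<Sum>i=1..n. z i ^ j * cnj (z i) ^ k))"
    unfolding sum_distrib_left by (intro sum.cong refl sum.swap)
  \<comment> \<open>Here \<open>m < n\<close> enters: it puts all exponents up to m in the range of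
    \<open>orth\<close>.\<close>
  also have "\<dots> = (\<Sum>j\<le>m. \<Sum>k\<le>m. if j = k then a j k * of_nat n else 0)"
    using assms(2) by (intro sum.cong refl) (subst orth, simp_all)
  also have "\<dots> = (\<Sum>j\<le>m. a j j * of_nat n)"
    by (intro sum.cong refl) simp
  also have "\<dots> = of_real (real n *
      (\<Sum>j\<le>m. real (m choose j) ^ 2 * R ^ (2 * j) * norm w ^ (2 * (m - j))))"
  proof -
    \<comment> \<open>On the diagonal the sign of -R occurs to the even power 2j, and the powers of
      \<open>w\<close> and \<open>cnj w\<close> combine into an even power of the norm.\<close>
    have "a j j = of_real (real (m choose j) ^ 2 * R ^ (2 * j) * norm w ^ (2 * (m - j)))" for j
    proof -
      have "(- complex_of_real R) ^ (j + j) = of_real R ^ (2 * j)"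
        by (simp flip: mult_2)
      thus ?thesis
        by (simp only: a_def of_real_mult of_real_norm_power_even)
           (simp add: power2_eq_square mult_ac)
    qed
    thus ?thesis
      by (simp add: sum_distrib_left mult_ac)
  qed
  finally have "(\<Sum>i=1..n. dist M (A i) ^ (2 * m)) = real n *
      (\<Sum>j\<le>m. real (m choose j) ^ 2 * R ^ (2 * j) * norm w ^ (2 * (m - j)))"
    by (simp only: of_real_eq_iff)
  thus ?thesis
    using n by (simp add: cyclic_average_def centroid w_def dist_norm)
qed

theorem mainTheorem5:
  fixes R L :: real
  assumes "R > 0" and "L \<ge> 0"
  shows "(\<forall>n\<^sub>1 n\<^sub>2 m A\<^sub>1 A\<^sub>2 M\<^sub>1 M\<^sub>2.
            3 \<le> n\<^sub>1 \<and> n\<^sub>1 \<le> n\<^sub>2 \<and> 1 \<le> m \<and> m \<le> n\<^sub>1 - 1 \<and>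
            regular_polygon n\<^sub>1 A\<^sub>1 R \<and> dist M\<^sub>1 (centroid n\<^sub>1 A\<^sub>1) = L \<and>
            regular_polygon n\<^sub>2 A\<^sub>2 R \<and> dist M\<^sub>2 (centroid n\<^sub>2 A\<^sub>2) = L \<longrightarrow>
            cyclic_average n\<^sub>1 A\<^sub>1 M\<^sub>1 (2 * m) = cyclic_average n\<^sub>2 A\<^sub>2 M\<^sub>2 (2 * m)) \<and>
         (\<forall>A M.
            (\<forall>n\<ge>3. regular_polygon n (A n) R \<and> dist (M n) (centroid n (A n)) = L) \<longrightarrow>
            (\<forall>n\<ge>3. cyclic_average n (A n) (M n) 2 = cyclic_average 3 (A 3) (M 3) 2) \<and>
            (\<forall>n\<ge>3. cyclic_average n (A n) (M n) 4 = cyclic_average 3 (A 3) (M 3) 4) \<and>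
            (\<forall>n\<ge>4. cyclic_average n (A n) (M n) 6 = cyclic_average 4 (A 4) (M 4) 6) \<and>
            (\<forall>n\<ge>5. cyclic_average n (A n) (M n) 8 = cyclic_average 5 (A 5) (M 5) 8))"
proof -
  have average_eq: "cyclic_average n A M (2 * m) = cyclic_average n' A' M' (2 * m)"
    if "regular_polygon n A R" "dist M (centroid n A) = L" "m < n"
      "regular_polygon n' A' R" "dist M' (centroid n' A') = L" "m < n'"
    for n n' m A A' M M'
    using that by (simp add: cyclic_average_regular_polygon)
  show ?thesis
  proof (intro conjI allI impI)
    fix n\<^sub>1 n\<^sub>2 m A\<^sub>1 A\<^sub>2 M\<^sub>1 M\<^sub>2
    assume "3 \<le> n\<^sub>1 \<and> n\<^sub>1 \<le> n\<^sub>2 \<and> 1 \<le> m \<and> m \<le> n\<^sub>1 - 1 \<and>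
      regular_polygon n\<^sub>1 A\<^sub>1 R \<and> dist M\<^sub>1 (centroid n\<^sub>1 A\<^sub>1) = L \<and>
      regular_polygon n\<^sub>2 A\<^sub>2 R \<and> dist M\<^sub>2 (centroid n\<^sub>2 A\<^sub>2) = L"
    thus "cyclic_average n\<^sub>1 A\<^sub>1 M\<^sub>1 (2 * m) = cyclic_average n\<^sub>2 A\<^sub>2 M\<^sub>2 (2 * m)"
      by (intro average_eq) auto
  next
    fix A M n
    assume *: "\<forall>n\<ge>3. regular_polygon n (A n) R \<and> dist (M n) (centroid n (A n)) = L"
    \<comment> \<open>Each chain is compared with its first member: \<open>k\<close> is the larger
      of 3 and m + 1, for m = 1, 2, 3, 4.\<close>
    have family_eq: "cyclic_average n (A n) (M n) (2 * m) = cyclic_average k (A k) (M k) (2 * m)"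
      if "3 \<le> k" "k \<le> n" "m < k" for k m
      using * that by (intro average_eq) auto
    show "cyclic_average n (A n) (M n) 2 = cyclic_average 3 (A 3) (M 3) 2" if "3 \<le> n"
      using family_eq[of 3 1] that by simp
    show "cyclic_average n (A n) (M n) 4 = cyclic_average 3 (A 3) (M 3) 4" if "3 \<le> n"
      using family_eq[of 3 2] that by simp
    show "cyclic_average n (A n) (M n) 6 = cyclic_average 4 (A 4) (M 4) 6" if "4 \<le> n"
      using family_eq[of 4 3] that by simp
    show "cyclic_average n (A n) (M n) 8 = cyclic_average 5 (A 5) (M 5) 8" if "5 \<le> n"
      using family_eq[of 5 4] that by simp
  qed
qed

end
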